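(* Fix natural numbers $\alpha \ge 1$ and $\beta \ge 1$. For each $n \in \mathbb{N}$ let $$a_{\alpha,\beta,n} := \#\{S \subset \{1,2,\ldots,n\} : S \text{ is } \alpha\text{-Schreier and } \beta\text{-Zeckendorf}\}.$$ Then for all $n \ge 1$, $$a_{\alpha,\beta,n} = \begin{cases} 1, & \text{for } n \le \alpha - 1;\\ n-\alpha+2, & \text{for } \alpha \le n \le 2\alpha+\beta-1;\\ a_{\alpha,\beta,n-1} + a_{\alpha,\beta,n-(\alpha+\beta)}, & \text{for } n \ge 2\alpha+\beta.\end{cases}$$
   Context: Natural numbers are positive integers, and $S \subset \{1,\ldots,n\}$ allows any subset (including the empty set and the whole set). A finite set $S$ of natural numbers is called $\alpha$-Schreier if $\min S/\alpha \ge |S|$, i.e. $\min S \ge \alpha |S|$, where $|S|$ is the cardinality of $S$; by convention the empty set is $\alpha$-Schreier. For a finite set $S = \{s_1 < s_2 < \cdots < s_k\}$ of natural numbers with $k \ge 2$, the difference set is $D(S) = \{s_2-s_1, s_3-s_2, \ldots, s_k-s_{k-1}\}$; for the empty set and one-element sets, $D(S) = \emptyset$. A finite set $S$ of natural numbers is called $\beta$-Zeckendorf if $\min D(S) \ge \beta$, i.e. any two distinct elements of $S$ differ by at least $\beta$; the empty set and one-element sets are vacuously $\beta$-Zeckendorf. *)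

theory Defs
  imports Complex_Main
begin

text \<open>
  The natural numbers of the paper are the positive integers; here sets have type
  \<^typ>\<open>nat set\<close>, and \<open>0\<close> is excluded by only counting subsets of \<open>{1..n}\<close>.
\<close>

text \<open>The library's \<^const>\<open>Min\<close> is unspecified on the empty set, so the conventions for
  \<open>S = {}\<close> and for an empty difference set are separate disjuncts.\<close>

definition schreier :: "nat \<Rightarrow> nat set \<Rightarrow> bool" where
  "schreier \<alpha> S \<longleftrightarrow> finite S \<and> (S = {} \<or> real (Min S) / real \<alpha> \<ge> real (card S))"

text \<open>Gaps between consecutive elements only; list positions count from \<open>0\<close>, so
  \<open>s\<^sub>i\<^sub>+\<^sub>1\<close> is \<open>sorted_list_of_set S ! i\<close>.\<close>

definition diff_set :: "nat set \<Rightarrow> nat set" where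
  "diff_set S =
     {sorted_list_of_set S ! Suc i - sorted_list_of_set S ! i | i. Suc i < card S}"

definition zeckendorf :: "nat \<Rightarrow> nat set \<Rightarrow> bool" where
  "zeckendorf \<beta> S \<longleftrightarrow> finite S \<and> (diff_set S = {} \<or> Min (diff_set S) \<ge> \<beta>)"

definition schreier_zeckendorf_count :: "nat \<Rightarrow> nat \<Rightarrow> nat \<Rightarrow> nat" where
  "schreier_zeckendorf_count \<alpha> \<beta> n = card {S. S \<subseteq> {1..n} \<and> schreier \<alpha> S \<and> zeckendorf \<beta> S}"

end

theory Submission
  imports Defs
begin

text \<open>
  Call a set admissible if it is both \<open>\<alpha>\<close>-Schreier and \<open>\<beta>\<close>-Zeckendorf, and split the admissible
  subsets of \<open>{1..n}\<close> by whether they contain \<open>n\<close>. Those that do not are the admissible subsets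
  of \<open>{1..n - 1}\<close>. Those that do arise exactly once by shifting an admissible
  \<open>T \<subseteq> {1..n - (\<alpha> + \<beta>)}\<close> upwards by \<open>\<alpha>\<close> and then adjoining \<open>n\<close>: the new element raises the
  cardinality by one, which costs the Schreier condition \<open>\<alpha>\<close>, and the shift pays for precisely
  that; the shifted set ends at \<open>n - \<beta>\<close> at the latest, which is the gap that the new maximum
  requires (\<open>bij_betw_shift_insert\<close>).

  If subtraction is truncated at \<open>0\<close>, this argument holds for every \<open>n \<ge> \<alpha>\<close>
  (\<open>schreier_zeckendorf_count_rec\<close>): when \<open>n \<le> \<alpha> + \<beta>\<close>, the only \<open>T\<close> is the empty set, and the
  only admissible set containing \<open>n\<close> is \<open>{n}\<close>. All three clauses follow from this one recurrence.
  Below \<open>\<alpha>\<close> the count is \<open>1\<close>, because an element of a nonempty admissible set is at least \<open>\<alpha>\<close>.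
  For \<open>\<alpha> \<le> n \<le> 2 * \<alpha> + \<beta> - 1\<close> the index \<open>n - (\<alpha> + \<beta>)\<close> lies below \<open>\<alpha>\<close>, so that each step of
  the recurrence adds \<open>1\<close>.
\<close>

lemma schreier_iff:
  assumes "\<alpha> \<ge> 1"
  shows "schreier \<alpha> S \<longleftrightarrow> finite S \<and> (\<forall>x\<in>S. \<alpha> * card S \<le> x)"
proof -
  have "real (card S) \<le> real m / real \<alpha> \<longleftrightarrow> \<alpha> * card S \<le> m" for m
  proof -
    have "real (card S) \<le> real m / real \<alpha> \<longleftrightarrow> real (card S) * real \<alpha> \<le> real m"
      using assms by (simp add: pos_le_divide_eq)
    also have "\<dots> \<longleftrightarrow> card S * \<alpha> \<le> m"
      by (metis of_nat_le_iff of_nat_mult)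
    finally show ?thesis by (simp add: mult.commute)
  qed
  then have "schreier \<alpha> S \<longleftrightarrow> finite S \<and> (S = {} \<or> \<alpha> * card S \<le> Min S)"
    unfolding schreier_def by metis
  then show ?thesis by (metis Min_ge_iff empty_iff)
qed

text \<open>Gaps between consecutive elements control all gaps, since the list of elements is
  increasing: an element larger than the \<open>i\<close>-th one is at least the next one.\<close>

lemma zeckendorf_iff:
  "zeckendorf \<beta> S \<longleftrightarrow> finite S \<and> (\<forall>x\<in>S. \<forall>y\<in>S. x < y \<longrightarrow> x + \<beta> \<le> y)"
proof (cases "finite S")
  case True
  define xs where "xs = sorted_list_of_set S"
  have len: "length xs = card S" and set_xs: "set xs = S"
    and strict: "sorted_wrt (<) xs" and sorted: "sorted xs"
    using True by (auto simp: xs_def)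
  have diff: "diff_set S = (\<lambda>i. xs ! Suc i - xs ! i) ` {i. Suc i < card S}"
    by (auto simp: diff_set_def xs_def)
  have "finite {i. Suc i < card S}"
    by (rule finite_subset[of _ "{..<card S}"]) auto
  then have "finite (diff_set S)" by (simp add: diff)
  then have "zeckendorf \<beta> S \<longleftrightarrow> (\<forall>d\<in>diff_set S. \<beta> \<le> d)"
    using True unfolding zeckendorf_def by (metis Min_ge_iff empty_iff)
  also have "\<dots> \<longleftrightarrow> (\<forall>i. Suc i < length xs \<longrightarrow> \<beta> \<le> xs ! Suc i - xs ! i)"
    by (auto simp: diff len)
  also have "\<dots> \<longleftrightarrow> (\<forall>x\<in>S. \<forall>y\<in>S. x < y \<longrightarrow> x + \<beta> \<le> y)"
  proof
    assume gaps: "\<forall>i. Suc i < length xs \<longrightarrow> \<beta> \<le> xs ! Suc i - xs ! i"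
    show "\<forall>x\<in>S. \<forall>y\<in>S. x < y \<longrightarrow> x + \<beta> \<le> y"
    proof (intro ballI impI)
      fix x y assume "x \<in> S" "y \<in> S" "x < y"
      then obtain i j where i: "i < length xs" "x = xs ! i" and j: "j < length xs" "y = xs ! j"
        using set_xs by (metis in_set_conv_nth)
      have "i < j"
        using sorted_nth_mono[OF sorted] i j \<open>x < y\<close> by (metis leD not_le)
      then have "xs ! Suc i \<le> y"
        using sorted_nth_mono[OF sorted] j by simp
      moreover have "\<beta> \<le> xs ! Suc i - xs ! i" "xs ! i < xs ! Suc i"
        using gaps \<open>i < j\<close> j strict by (auto simp: sorted_wrt_iff_nth_less)
      ultimately show "x + \<beta> \<le> y" using i by linarith
    qed
  next
    assume sep: "\<forall>x\<in>S. \<forall>y\<in>S. x < y \<longrightarrow> x + \<beta> \<le> y"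
    show "\<forall>i. Suc i < length xs \<longrightarrow> \<beta> \<le> xs ! Suc i - xs ! i"
    proof (intro allI impI)
      fix i assume i: "Suc i < length xs"
      then have "xs ! i < xs ! Suc i"
        using strict by (simp add: sorted_wrt_iff_nth_less)
      moreover have "xs ! i \<in> S" "xs ! Suc i \<in> S"
        using i set_xs by (metis Suc_lessD nth_mem)+
      ultimately have "xs ! i + \<beta> \<le> xs ! Suc i" using sep by blast
      then show "\<beta> \<le> xs ! Suc i - xs ! i" by linarith
    qed
  qed
  finally show ?thesis using True by simp
qed (simp add: zeckendorf_def)

definition admissible :: "nat \<Rightarrow> nat \<Rightarrow> nat \<Rightarrow> nat set set" where
  "admissible \<alpha> \<beta> n = {S. S \<subseteq> {1..n} \<and> schreier \<alpha> S \<and> zeckendorf \<beta> S}"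

lemma mem_admissible_iff:
  assumes "\<alpha> \<ge> 1"
  shows "S \<in> admissible \<alpha> \<beta> n \<longleftrightarrow>
    S \<subseteq> {1..n} \<and> (\<forall>x\<in>S. \<alpha> * card S \<le> x) \<and> (\<forall>x\<in>S. \<forall>y\<in>S. x < y \<longrightarrow> x + \<beta> \<le> y)"
  unfolding admissible_def mem_Collect_eq schreier_iff[OF assms] zeckendorf_iff
  using finite_subset[of S "{1..n}"] by auto

lemma finite_admissible: "finite (admissible \<alpha> \<beta> n)"
  by (rule finite_subset[of _ "Pow {1..n}"]) (auto simp: admissible_def)

lemma shift_insert_admissible:
  assumes "\<alpha> \<ge> 1" "\<alpha> \<le> n" and T: "T \<in> admissible \<alpha> \<beta> (n - (\<alpha> + \<beta>))"
  shows "insert n ((+) \<alpha> ` T) \<in> admissible \<alpha> \<beta> n"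
proof -
  have sub: "T \<subseteq> {1..n - (\<alpha> + \<beta>)}" and large: "\<And>x. x \<in> T \<Longrightarrow> \<alpha> * card T \<le> x"
    and sep: "\<And>x y. x \<in> T \<Longrightarrow> y \<in> T \<Longrightarrow> x < y \<Longrightarrow> x + \<beta> \<le> y"
    using T by (auto simp: mem_admissible_iff[OF assms(1)])
  have bounds: "1 \<le> x" "x + \<alpha> + \<beta> \<le> n" if "x \<in> T" for x
    using that sub by fastforce+
  let ?S = "insert n ((+) \<alpha> ` T)"
  have "finite T" using sub finite_subset by blast
  then have "card ?S \<le> Suc (card T)"
    by (simp add: card_image card_insert_if)
  then have card: "\<alpha> * card ?S \<le> \<alpha> + \<alpha> * card T"
    by (metis mult_Suc_right mult_le_mono2)
  \<comment> \<open>For the new maximum, any element of \<open>T\<close> is a large enough witness; if there is none, then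
    the set is \<open>{n}\<close>, which is where \<open>\<alpha> \<le> n\<close> enters.\<close>
  have card_le: "\<alpha> * card ?S \<le> n"
  proof (cases "T = {}")
    case False
    then obtain t where "t \<in> T" by blast
    then show ?thesis using large[of t] bounds[of t] card by linarith
  qed (use assms in simp)
  have "\<forall>x\<in>?S. \<alpha> * card ?S \<le> x"
  proof -
    have "\<alpha> * card ?S \<le> \<alpha> + x" if "x \<in> T" for x
      using card large[OF that] by linarith
    then show ?thesis using card_le by blast
  qed
  moreover have "?S \<subseteq> {1..n}" using bounds assms by fastforce
  moreover have "x + \<beta> \<le> y" if "x \<in> ?S" "y \<in> ?S" "x < y" for x y
    using that sep bounds by fastforce
  ultimately show ?thesis unfolding mem_admissible_iff[OF assms(1)] by blast
qed

text \<open>A set that contains \<open>n\<close> and a further element has cardinality at least \<open>2\<close>, hence its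
  elements are at least \<open>2 * \<alpha>\<close>: the downward shift by \<open>\<alpha>\<close> keeps them positive, and no
  subtraction is truncated.\<close>

lemma unshift_remove_admissible:
  assumes "\<alpha> \<ge> 1" and S: "S \<in> admissible \<alpha> \<beta> n" and "n \<in> S"
  shows "(\<lambda>x. x - \<alpha>) ` (S - {n}) \<in> admissible \<alpha> \<beta> (n - (\<alpha> + \<beta>))"
    and "\<forall>x\<in>S - {n}. \<alpha> \<le> x"
proof -
  have sub: "S \<subseteq> {1..n}" and large: "\<And>x. x \<in> S \<Longrightarrow> \<alpha> * card S \<le> x"
    and sep: "\<And>x y. x \<in> S \<Longrightarrow> y \<in> S \<Longrightarrow> x < y \<Longrightarrow> x + \<beta> \<le> y"
    using S by (auto simp: mem_admissible_iff[OF assms(1)])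
  let ?R = "S - {n}"
  have fin: "finite S" using sub finite_subset by blast
  have card: "card S = Suc (card ?R)"
    using fin \<open>n \<in> S\<close> by (metis card.remove)
  have ge: "\<alpha> + \<alpha> * card ?R \<le> x" "2 * \<alpha> \<le> x" if "x \<in> ?R" for x
  proof -
    show "\<alpha> + \<alpha> * card ?R \<le> x" using large[of x] that card by simp
    moreover have "1 \<le> card ?R" using that fin by (auto simp: Suc_le_eq card_gt_0_iff)
    then have "\<alpha> * 1 \<le> \<alpha> * card ?R" by (rule mult_le_mono2)
    ultimately show "2 * \<alpha> \<le> x" by linarith
  qed
  then show "\<forall>x\<in>?R. \<alpha> \<le> x" by fastforce
  have le: "x + \<beta> \<le> n" if "x \<in> ?R" for x
    using sep[of x n] sub that \<open>n \<in> S\<close> by fastforce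
  let ?T = "(\<lambda>x. x - \<alpha>) ` ?R"
  have "card ?T \<le> card ?R" using fin by (simp add: card_image_le)
  then have card_T: "\<alpha> * card ?T \<le> \<alpha> * card ?R" by (rule mult_le_mono2)
  have "\<alpha> * card ?T \<le> x - \<alpha>" if "x \<in> ?R" for x
    using ge(1)[OF that] card_T by linarith
  then have "\<forall>t\<in>?T. \<alpha> * card ?T \<le> t" by blast
  moreover have "?T \<subseteq> {1..n - (\<alpha> + \<beta>)}"
  proof
    fix t assume "t \<in> ?T"
    then obtain x where "x \<in> ?R" "t = x - \<alpha>" by blast
    then have "1 \<le> t" "t \<le> n - (\<alpha> + \<beta>)"
      using ge(2)[of x] le[of x] \<open>\<alpha> \<ge> 1\<close> by linarith+
    then show "t \<in> {1..n - (\<alpha> + \<beta>)}" by simp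
  qed
  moreover have "s + \<beta> \<le> t" if st: "s \<in> ?T" "t \<in> ?T" "s < t" for s t
  proof -
    obtain x y where xy: "x \<in> ?R" "s = x - \<alpha>" "y \<in> ?R" "t = y - \<alpha>" using st by blast
    then have "x < y" using \<open>s < t\<close> by linarith
    then have "x + \<beta> \<le> y" using sep xy by blast
    then show ?thesis using ge(2)[of x] xy by linarith
  qed
  ultimately show "?T \<in> admissible \<alpha> \<beta> (n - (\<alpha> + \<beta>))"
    unfolding mem_admissible_iff[OF assms(1)] by blast
qed

lemma bij_betw_shift_insert:
  assumes "\<alpha> \<ge> 1" "\<beta> \<ge> 1" "\<alpha> \<le> n"
  shows "bij_betw (\<lambda>T. insert n ((+) \<alpha> ` T))
    (admissible \<alpha> \<beta> (n - (\<alpha> + \<beta>))) {S \<in> admissible \<alpha> \<beta> n. n \<in> S}"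
proof (rule bij_betw_byWitness[where f' = "\<lambda>S. (\<lambda>x. x - \<alpha>) ` (S - {n})"])
  show "\<forall>T\<in>admissible \<alpha> \<beta> (n - (\<alpha> + \<beta>)).
      (\<lambda>x. x - \<alpha>) ` (insert n ((+) \<alpha> ` T) - {n}) = T"
  proof
    fix T assume "T \<in> admissible \<alpha> \<beta> (n - (\<alpha> + \<beta>))"
    then have "T \<subseteq> {1..n - (\<alpha> + \<beta>)}" by (simp add: admissible_def)
    \<comment> \<open>Here \<open>\<beta> \<ge> 1\<close> matters: it keeps the shifted set strictly below \<open>n\<close>.\<close>
    then have "n \<notin> (+) \<alpha> ` T" using \<open>\<beta> \<ge> 1\<close> by fastforce
    then have "insert n ((+) \<alpha> ` T) - {n} = (+) \<alpha> ` T" by blast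
    then show "(\<lambda>x. x - \<alpha>) ` (insert n ((+) \<alpha> ` T) - {n}) = T"
      by (simp add: image_image)
  qed
  show "\<forall>S\<in>{S \<in> admissible \<alpha> \<beta> n. n \<in> S}.
      insert n ((+) \<alpha> ` (\<lambda>x. x - \<alpha>) ` (S - {n})) = S"
  proof
    fix S assume S: "S \<in> {S \<in> admissible \<alpha> \<beta> n. n \<in> S}"
    then have "\<forall>x\<in>S - {n}. \<alpha> \<le> x"
      using unshift_remove_admissible(2) assms(1) by blast
    then have "(\<lambda>x. \<alpha> + (x - \<alpha>)) ` (S - {n}) = S - {n}" by (force simp: image_iff)
    then show "insert n ((+) \<alpha> ` (\<lambda>x. x - \<alpha>) ` (S - {n})) = S"
      using S by (auto simp: image_image)
  qed
qed (use shift_insert_admissible unshift_remove_admissible(1) assms in blast)+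

lemma schreier_zeckendorf_count_rec:
  assumes "\<alpha> \<ge> 1" "\<beta> \<ge> 1" "\<alpha> \<le> n"
  shows "schreier_zeckendorf_count \<alpha> \<beta> n =
    schreier_zeckendorf_count \<alpha> \<beta> (n - 1) + schreier_zeckendorf_count \<alpha> \<beta> (n - (\<alpha> + \<beta>))"
proof -
  let ?In = "{S \<in> admissible \<alpha> \<beta> n. n \<in> S}"
  have "S \<subseteq> {1..n} \<and> n \<notin> S \<longleftrightarrow> S \<subseteq> {1..n - 1}" for S
  proof -
    have "{1..n - 1} = {1..n} - {n}" using assms by auto
    then show ?thesis by auto
  qed
  then have split: "admissible \<alpha> \<beta> n = admissible \<alpha> \<beta> (n - 1) \<union> ?In"
    and disj: "admissible \<alpha> \<beta> (n - 1) \<inter> ?In = {}"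
    unfolding admissible_def by blast+
  have "finite ?In" using finite_admissible[of \<alpha> \<beta> n] by simp
  then have "card (admissible \<alpha> \<beta> n) = card (admissible \<alpha> \<beta> (n - 1)) + card ?In"
    using split disj finite_admissible by (metis card_Un_disjoint)
  also have "card ?In = card (admissible \<alpha> \<beta> (n - (\<alpha> + \<beta>)))"
    using bij_betw_same_card[OF bij_betw_shift_insert[OF assms]] by simp
  finally show ?thesis
    by (simp add: schreier_zeckendorf_count_def admissible_def)
qed

lemma schreier_zeckendorf_count_below:
  assumes "\<alpha> \<ge> 1" "n < \<alpha>"
  shows "schreier_zeckendorf_count \<alpha> \<beta> n = 1"
proof -
  have "S = {}" if S: "S \<in> admissible \<alpha> \<beta> n" for S
  proof (rule ccontr)
    assume "S \<noteq> {}"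
    then obtain x where "x \<in> S" by blast
    have sub: "S \<subseteq> {1..n}" and "\<alpha> * card S \<le> x"
      using S \<open>x \<in> S\<close> by (auto simp: mem_admissible_iff[OF assms(1)])
    moreover have "1 \<le> card S"
      using sub \<open>x \<in> S\<close> finite_subset[OF sub] by (auto simp: Suc_le_eq card_gt_0_iff)
    then have "\<alpha> * 1 \<le> \<alpha> * card S" by (rule mult_le_mono2)
    moreover have "x \<le> n" using sub \<open>x \<in> S\<close> by auto
    ultimately show False using \<open>n < \<alpha>\<close> by linarith
  qed
  moreover have "{} \<in> admissible \<alpha> \<beta> n" by (simp add: mem_admissible_iff[OF assms(1)])
  ultimately have "admissible \<alpha> \<beta> n = {{}}" by blast
  then show ?thesis by (simp add: schreier_zeckendorf_count_def admissible_def)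
qed

theorem theorem1p3:
  fixes \<alpha> \<beta> :: nat
  assumes "\<alpha> \<ge> 1" and "\<beta> \<ge> 1"
  shows "\<forall>n\<ge>1.
           (n \<le> \<alpha> - 1 \<longrightarrow> schreier_zeckendorf_count \<alpha> \<beta> n = 1) \<and>
           (\<alpha> \<le> n \<and> n \<le> 2 * \<alpha> + \<beta> - 1 \<longrightarrow> schreier_zeckendorf_count \<alpha> \<beta> n = n - \<alpha> + 2) \<and>
           (n \<ge> 2 * \<alpha> + \<beta> \<longrightarrow> schreier_zeckendorf_count \<alpha> \<beta> n = schreier_zeckendorf_count \<alpha> \<beta> (n - 1) + schreier_zeckendorf_count \<alpha> \<beta> (n - (\<alpha> + \<beta>)))"
proof -
  note below = schreier_zeckendorf_count_below[OF assms(1)]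
  note rec = schreier_zeckendorf_count_rec[OF assms]
  have linear: "n \<le> 2 * \<alpha> + \<beta> - 1 \<longrightarrow> schreier_zeckendorf_count \<alpha> \<beta> n = n - \<alpha> + 2"
    if "\<alpha> \<le> n" for n
    using that
  proof (induction n rule: dec_induct)
    case base
    then show ?case using rec[of \<alpha>] below[of "\<alpha> - 1"] below[of 0] assms by simp
  next
    case (step n)
    show ?case
    proof
      assume "Suc n \<le> 2 * \<alpha> + \<beta> - 1"
      then have "schreier_zeckendorf_count \<alpha> \<beta> (Suc n - (\<alpha> + \<beta>)) = 1"
        using assms by (intro below) linarith
      then show "schreier_zeckendorf_count \<alpha> \<beta> (Suc n) = Suc n - \<alpha> + 2"
        using rec[of "Suc n"] step \<open>Suc n \<le> 2 * \<alpha> + \<beta> - 1\<close> by simp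
    qed
  qed
  show ?thesis
  proof (intro allI impI conjI)
    fix n :: nat
    assume "n \<le> \<alpha> - 1"
    then show "schreier_zeckendorf_count \<alpha> \<beta> n = 1" using below assms by simp
  next
    fix n :: nat
    assume "\<alpha> \<le> n \<and> n \<le> 2 * \<alpha> + \<beta> - 1"
    then show "schreier_zeckendorf_count \<alpha> \<beta> n = n - \<alpha> + 2" using linear by blast
  next
    fix n :: nat
    assume "2 * \<alpha> + \<beta> \<le> n"
    then show "schreier_zeckendorf_count \<alpha> \<beta> n =
        schreier_zeckendorf_count \<alpha> \<beta> (n - 1) + schreier_zeckendorf_count \<alpha> \<beta> (n - (\<alpha> + \<beta>))"
      by (intro rec) linarith
  qed
qed

end
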